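(* Let $E$ be a field and let $F \subseteq E$ be a subfield. If $E$ is rootless, then $F$ is rootless. If $E$ is rootless modtor, then $F$ is rootless modtor. If $E$ has good heredity, then $F$ has good heredity.
   Context: Let $F$ be a field with algebraic closure $F^{alg}$. A polynomial $P \in F[x]$ is hereditarily irreducible over $F$ if for every integer $n\ge 1$ the polynomial $P(x^n)$ is irreducible over $F$. A polynomial $P\in F[x]$ has good heredity (over $F$) if for some integer $n \geq 1$ the polynomial $P(x^n)$ factors (up to a nonzero constant) as a product of polynomials in $F[x]$ that are hereditarily irreducible over $F$. The field $F$ has good heredity if every polynomial $P \in F[x]$, none of whose roots in $F^{alg}$ is zero or a root of unity, has good heredity over $F$. An element $a \in F$ that is not a root of unity is rootless (in $F$) if for all but finitely many integers $n\ge 1$ the equation $x^n = a$ has no solution in $F$. An element $a\in F$ that is not a root of unity is rootless modtor (in $F$) if for all but finitely many integers $n\ge 1$, for every root of unity $\zeta \in F$ the equation $x^n=\zeta a$ has no solution in $F$. The field $F$ is rootless (resp. rootless modtor) if every nonzero $f \in F$ that is not a root of unity is rootless (resp. rootless modtor) in $F$. *)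

theory Defs
  imports "HOL-Algebra.Algebra"
begin

section \<open>Rootless fields\<close>

definition root_of_unity :: "('a, 'b) ring_scheme \<Rightarrow> 'a \<Rightarrow> bool"
  where "root_of_unity R a \<longleftrightarrow> a \<in> carrier R \<and> (\<exists>n::nat. n \<ge> 1 \<and> a [^]\<^bsub>R\<^esub> n = \<one>\<^bsub>R\<^esub>)"

definition rootless_elem :: "('a, 'b) ring_scheme \<Rightarrow> 'a \<Rightarrow> bool"
  where "rootless_elem R a \<longleftrightarrow>
           a \<in> carrier R \<and> \<not> root_of_unity R a \<and>
           finite {n::nat. n \<ge> 1 \<and> (\<exists>x \<in> carrier R. x [^]\<^bsub>R\<^esub> n = a)}"

definition rootless_modtor_elem :: "('a, 'b) ring_scheme \<Rightarrow> 'a \<Rightarrow> bool"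
  where "rootless_modtor_elem R a \<longleftrightarrow>
           a \<in> carrier R \<and> \<not> root_of_unity R a \<and>
           finite {n::nat. n \<ge> 1 \<and>
             (\<exists>\<zeta>. root_of_unity R \<zeta> \<and> (\<exists>x \<in> carrier R. x [^]\<^bsub>R\<^esub> n = \<zeta> \<otimes>\<^bsub>R\<^esub> a))}"

definition rootless :: "('a, 'b) ring_scheme \<Rightarrow> bool"
  where "rootless R \<longleftrightarrow>
           (\<forall>f \<in> carrier R. f \<noteq> \<zero>\<^bsub>R\<^esub> \<longrightarrow> \<not> root_of_unity R f \<longrightarrow> rootless_elem R f)"

definition rootless_modtor :: "('a, 'b) ring_scheme \<Rightarrow> bool"
  where "rootless_modtor R \<longleftrightarrow>
           (\<forall>f \<in> carrier R. f \<noteq> \<zero>\<^bsub>R\<^esub> \<longrightarrow> \<not> root_of_unity R f \<longrightarrow> rootless_modtor_elem R f)"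


section \<open>Good heredity\<close>

text \<open>
  The polynomial \<open>P(x\<^sup>n)\<close>: coefficients are turned into constant polynomials, and the result is
  evaluated at \<open>x\<^sup>n\<close> in the polynomial ring.
\<close>

definition subst_power :: "('a, 'b) ring_scheme \<Rightarrow> 'a list \<Rightarrow> nat \<Rightarrow> 'a list"
  where "subst_power R P n =
           ring.eval (poly_ring R) (map (ring.poly_of_const R) P) (X\<^bsub>R\<^esub> [^]\<^bsub>poly_ring R\<^esub> n)"

definition hereditarily_irreducible :: "('a, 'b) ring_scheme \<Rightarrow> 'a list \<Rightarrow> bool"
  where "hereditarily_irreducible R P \<longleftrightarrow>
           P \<in> carrier (poly_ring R) \<and>
           (\<forall>n::nat. n \<ge> 1 \<longrightarrow> pirreducible\<^bsub>R\<^esub> (carrier R) (subst_power R P n))"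

text \<open>
  The list \<open>Qs\<close> of factors may be empty, so nonzero constant polynomials have good heredity.
  They have no roots, hence without this convention no field would have good heredity.
\<close>

definition poly_good_heredity :: "('a, 'b) ring_scheme \<Rightarrow> 'a list \<Rightarrow> bool"
  where "poly_good_heredity R P \<longleftrightarrow>
           P \<in> carrier (poly_ring R) \<and>
           (\<exists>n::nat. n \<ge> 1 \<and>
             (\<exists>c \<in> carrier R - {\<zero>\<^bsub>R\<^esub>}. \<exists>Qs.
               (\<forall>Q \<in> set Qs. hereditarily_irreducible R Q) \<and>
               subst_power R P n =
                 [c] \<otimes>\<^bsub>poly_ring R\<^esub> foldr (\<otimes>\<^bsub>poly_ring R\<^esub>) Qs \<one>\<^bsub>poly_ring R\<^esub>))"

text \<open>
  The coefficients of \<open>P\<close> are moved to the library's algebraic closure of \<open>R\<close> along its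
  embedding \<^const>\<open>ring.indexed_const\<close>. We do not use \<^const>\<open>ring.is_root\<close>, which excludes the
  zero polynomial: here every element, in particular zero, is a root of the zero polynomial.
\<close>

definition good_heredity :: "('a, 'b) ring_scheme \<Rightarrow> bool"
  where "good_heredity R \<longleftrightarrow>
           (\<forall>P \<in> carrier (poly_ring R).
             (\<forall>x \<in> carrier (field.alg_closure R).
                ring.eval (field.alg_closure R) (map (ring.indexed_const R) P) x
                    = \<zero>\<^bsub>field.alg_closure R\<^esub> \<longrightarrow>
                x \<noteq> \<zero>\<^bsub>field.alg_closure R\<^esub> \<and> \<not> root_of_unity (field.alg_closure R) x) \<longrightarrow>
             poly_good_heredity R P)"

end

theory Submission
  imports Defs
begin

text \<open>
  Rootlessness descends to a subfield because solvability of \<open>x\<^sup>n = a\<close> (or \<open>x\<^sup>n = \<zeta> a\<close>) in the subfield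
  implies solvability in the larger field, and being a root of unity does not depend on the field.

  For good heredity the irreducible factors over \<open>E\<close> need not have coefficients in \<open>F\<close>, so the
  factorization itself does not descend. What descends is a bound on the number of factors. Suppose
  that \<open>P \<in> F[x]\<close> and that \<open>P(x\<^sup>n)\<close> is, up to a constant, a product of \<open>r\<close> hereditarily irreducible polynomials over \<open>E\<close>.
  Then for every \<open>m\<close> the polynomial \<open>P(x\<^sup>n\<^sup>m)\<close> is again a product of \<open>r\<close> irreducible polynomials over \<open>E\<close>,
  and so has at most \<open>r\<close> nonconstant factors in any factorization over \<open>E\<close>, in particular over \<open>F\<close>
  (\<open>length_factorization_le_hereditary\<close>). Choosing \<open>m\<close> and a factorization of \<open>P(x\<^sup>n\<^sup>m)\<close> over \<open>F\<close> with as
  many nonconstant factors as possible, each factor must be hereditarily irreducible over \<open>F\<close>, since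
  otherwise a further substitution would allow a longer factorization
  (\<open>poly_good_heredity_if_bounded\<close>).

  This can be applied once the roots of \<open>P\<close> in the algebraic closure of \<open>E\<close> are known to avoid \<open>0\<close> and
  the roots of unity. The two closures are unrelated constructions, but two polynomials over \<open>F\<close> with
  a common root in one field extension have a common root in every algebraically closed one
  (\<open>common_root_in_algebraically_closed\<close>); this is used for \<open>P\<close> together with \<open>X\<close> or \<open>X\<^sup>n - 1\<close>.
\<close>

section \<open>Substituting a power of the variable\<close>

text \<open>
  This single fact serves twice: with \<open>h\<close> the embedding of constants it makes \<open>P \<mapsto> P(x\<^sup>n)\<close> a ring
  homomorphism, and with \<open>h\<close> the embedding into an algebraic closure it makes evaluation at a point
  of the closure one. Polynomial arithmetic commutes with \<open>map h\<close> only up to removing leading zeros,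
  which evaluation does not see.
\<close>

lemma (in ring_hom_ring) eval_map_ring_hom:
  assumes "cring S" and x: "x \<in> carrier S"
  shows "(\<lambda>p. S.eval (map h p) x) \<in> ring_hom (poly_ring R) S"
proof -
  interpret S': cring S by (rule assms(1))
  have coeffs: "set p \<subseteq> carrier R" if "p \<in> carrier (poly_ring R)" for p
    using that unfolding sym[OF univ_poly_carrier] polynomial_def by auto
  have map_coeffs: "set (map h p) \<subseteq> carrier S" if "set p \<subseteq> carrier R" for p
    using that by auto
  show ?thesis
  proof (rule ring_hom_memI)
    fix p assume "p \<in> carrier (poly_ring R)"
    from S.eval_in_carrier[OF map_coeffs[OF coeffs[OF this]] x]
    show "S.eval (map h p) x \<in> carrier S" .
  next
    fix p q assume "p \<in> carrier (poly_ring R)" "q \<in> carrier (poly_ring R)"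
    note p = coeffs[OF this(1)] and q = coeffs[OF this(2)]
    have "S.eval (map h (R.poly_mult p q)) x = S.eval (S.normalize (map h (R.poly_mult p q))) x"
      using S.eval_normalize[OF map_coeffs[OF R.poly_mult_in_carrier[OF p q]] x] by simp
    also have "\<dots> = S.eval (map h p) x \<otimes>\<^bsub>S\<^esub> S.eval (map h q) x"
      unfolding poly_mult_hom'[OF p q] by (rule S'.eval_poly_mult[OF map_coeffs[OF p] map_coeffs[OF q] x])
    finally show "S.eval (map h (p \<otimes>\<^bsub>poly_ring R\<^esub> q)) x = S.eval (map h p) x \<otimes>\<^bsub>S\<^esub> S.eval (map h q) x"
      unfolding univ_poly_mult .
    have "S.eval (map h (R.poly_add p q)) x = S.eval (S.normalize (map h (R.poly_add p q))) x"
      using S.eval_normalize[OF map_coeffs[OF R.poly_add_in_carrier[OF p q]] x] by simp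
    also have "\<dots> = S.eval (map h p) x \<oplus>\<^bsub>S\<^esub> S.eval (map h q) x"
      unfolding poly_add_hom'[OF p q] by (rule S.eval_poly_add[OF map_coeffs[OF p] map_coeffs[OF q] x])
    finally show "S.eval (map h (p \<oplus>\<^bsub>poly_ring R\<^esub> q)) x = S.eval (map h p) x \<oplus>\<^bsub>S\<^esub> S.eval (map h q) x"
      unfolding univ_poly_add .
  next
    show "S.eval (map h \<one>\<^bsub>poly_ring R\<^esub>) x = \<one>\<^bsub>S\<^esub>"
      by (simp add: univ_poly_one)
  qed
qed

lemma (in domain) subst_power_hom:
  "(\<lambda>p. subst_power R p n) \<in> ring_hom (poly_ring R) (poly_ring R)"
proof -
  interpret UP: domain "poly_ring R"
    by (rule univ_poly_is_domain[OF carrier_is_subring])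
  interpret C: ring_hom_ring R "poly_ring R" poly_of_const
    using canonical_embedding_ring_hom[OF carrier_is_subring] by simp
  show ?thesis
    unfolding subst_power_def
    using C.eval_map_ring_hom[OF UP.is_cring var_pow_closed[OF carrier_is_subring]] .
qed

lemma (in domain) subst_power_closed:
  "p \<in> carrier (poly_ring R) \<Longrightarrow> subst_power R p n \<in> carrier (poly_ring R)"
  using ring_hom_memE(1)[OF subst_power_hom] .

lemma (in domain) subst_power_const:
  "c \<in> carrier R - {\<zero>} \<Longrightarrow> subst_power R [c] n = [c]"
proof -
  interpret UP: domain "poly_ring R"
    by (rule univ_poly_is_domain[OF carrier_is_subring])
  assume c: "c \<in> carrier R - {\<zero>}"
  then have "[c] \<in> carrier (poly_ring R)"
    unfolding sym[OF univ_poly_carrier] polynomial_def by auto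
  with c show ?thesis
    unfolding subst_power_def poly_of_const_def by simp
qed

text \<open>
  The substitution \<open>x \<mapsto> x\<^sup>m\<close> is a ring homomorphism fixing the constants, so it may be pushed through
  the evaluation that defines \<open>P(x\<^sup>n)\<close>, where it only changes the point \<open>x\<^sup>n\<close> to \<open>x\<^sup>n\<^sup>m\<close>.
\<close>

lemma (in domain) subst_power_compose:
  assumes p: "p \<in> carrier (poly_ring R)"
  shows "subst_power R (subst_power R p n) m = subst_power R p (n * m)"
proof -
  interpret UP: domain "poly_ring R"
    by (rule univ_poly_is_domain[OF carrier_is_subring])
  interpret C: ring_hom_ring R "poly_ring R" poly_of_const
    using canonical_embedding_ring_hom[OF carrier_is_subring] by simp
  let ?h = "\<lambda>q. subst_power R q m"
  interpret H: ring_hom_ring "poly_ring R" "poly_ring R" ?h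
    by (rule ring_hom_ringI2[OF UP.ring_axioms UP.ring_axioms subst_power_hom])
  note X = var_closed(1)[OF carrier_is_subring]
  have coeffs: "set p \<subseteq> carrier R"
    using p unfolding sym[OF univ_poly_carrier] polynomial_def by auto
  have const: "?h (poly_of_const a) = poly_of_const a" if "a \<in> carrier R" for a
  proof (cases "a = \<zero>")
    case True
    then show ?thesis
      by (simp add: poly_of_const_def subst_power_def univ_poly_zero)
  next
    case False
    with that show ?thesis using subst_power_const[of a m] by (simp add: poly_of_const_def)
  qed
  have "?h X = UP.eval (map poly_of_const X) (X [^]\<^bsub>poly_ring R\<^esub> m)"
    unfolding subst_power_def ..
  also have "\<dots> = X [^]\<^bsub>poly_ring R\<^esub> m"
    using UP.eval_var[OF var_pow_closed[OF carrier_is_subring, of m]]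
    by (simp add: var_def poly_of_const_def univ_poly_zero univ_poly_one)
  finally have hX: "?h X = X [^]\<^bsub>poly_ring R\<^esub> m" .
  have hXn: "?h (X [^]\<^bsub>poly_ring R\<^esub> n) = X [^]\<^bsub>poly_ring R\<^esub> (n * m)"
    using H.hom_nat_pow[OF X, of n] unfolding hX by (simp add: UP.nat_pow_pow[OF X] mult.commute)
  have "?h (subst_power R p n) = UP.eval (map ?h (map poly_of_const p)) (?h (X [^]\<^bsub>poly_ring R\<^esub> n))"
    unfolding subst_power_def[of R p n]
    by (rule H.eval_hom'[OF var_pow_closed[OF carrier_is_subring]]) (use coeffs in auto)
  also have "map ?h (map poly_of_const p) = map poly_of_const p"
    using const coeffs by auto
  finally show ?thesis
    unfolding hXn by (simp add: subst_power_def)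
qed

lemma (in domain) length_monomial:
  assumes "a \<in> carrier R - {\<zero>}"
  shows "length (poly_of_const a \<otimes>\<^bsub>poly_ring R\<^esub> (X [^]\<^bsub>poly_ring R\<^esub> n)) = Suc n"
proof -
  have "poly_of_const a \<otimes>\<^bsub>poly_ring R\<^esub> (X [^]\<^bsub>poly_ring R\<^esub> n) = monom a n"
    using monom_eq_var_pow[OF carrier_is_subring assms, of n] assms by (simp add: poly_of_const_def)
  then show ?thesis by (simp add: monom_def)
qed

text \<open>
  The length, unlike the degree, tells the zero polynomial from the nonzero constants; so this also
  says that the substitution is injective and preserves being nonconstant. The leading
  monomial of \<open>P\<close> contributes a term that is strictly longer than what the remaining coefficients
  give, so it cannot cancel. The inner bound is stated for arbitrary coefficient lists
  because the tail of a polynomial may begin with zeros.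
\<close>

lemma (in domain) length_subst_power:
  assumes "p \<in> carrier (poly_ring R)" and n: "n \<ge> 1"
  shows "length (subst_power R p n) = (if p = [] then 0 else Suc (n * degree p))"
proof -
  interpret UP: domain "poly_ring R"
    by (rule univ_poly_is_domain[OF carrier_is_subring])
  interpret C: ring_hom_ring R "poly_ring R" poly_of_const
    using canonical_embedding_ring_hom[OF carrier_is_subring] by simp
  let ?Xn = "X [^]\<^bsub>poly_ring R\<^esub> n"
  let ?ev = "\<lambda>q. UP.eval (map poly_of_const q) ?Xn"
  note X = var_closed(1)[OF carrier_is_subring]
  note Xn = var_pow_closed[OF carrier_is_subring, of n]
  have ev_closed: "?ev q \<in> carrier (poly_ring R)" if "set q \<subseteq> carrier R" for q
    by (rule UP.eval_in_carrier[OF _ Xn]) (use that in auto)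
  have ev_Cons: "?ev (a # q) = poly_add (poly_of_const a \<otimes>\<^bsub>poly_ring R\<^esub> (X [^]\<^bsub>poly_ring R\<^esub> (n * length q))) (?ev q)" for a q
    by (simp add: UP.nat_pow_pow[OF X] univ_poly_add)
  have bound: "length (?ev q) \<le> (if q = [] then 0 else Suc (n * degree q))" if "set q \<subseteq> carrier R" for q
    using that
  proof (induction q)
    case Nil
    then show ?case by (simp add: univ_poly_zero)
  next
    case (Cons a q)
    let ?m = "poly_of_const a \<otimes>\<^bsub>poly_ring R\<^esub> (X [^]\<^bsub>poly_ring R\<^esub> (n * length q))"
    have "length ?m \<le> Suc (n * length q)"
    proof (cases "a = \<zero>")
      case True
      then have "?m = \<zero>\<^bsub>poly_ring R\<^esub>"
        using UP.l_null[OF var_pow_closed[OF carrier_is_subring, of "n * length q"]]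
        by (simp add: poly_of_const_def univ_poly_zero)
      then show ?thesis by (simp add: univ_poly_zero)
    next
      case False
      with Cons.prems show ?thesis using length_monomial[of a "n * length q"] by simp
    qed
    moreover have "length (?ev q) \<le> (if q = [] then 0 else Suc (n * degree q))"
      using Cons by simp
    then have "length (?ev q) \<le> Suc (n * length q)"
      by (rule order_trans) simp
    ultimately have "length (poly_add ?m (?ev q)) \<le> Suc (n * length q)"
      using poly_add_length_le[of ?m "?ev q"] by (simp del: poly_add.simps)
    then show ?case unfolding ev_Cons by simp
  qed
  show ?thesis
  proof (cases p)
    case Nil
    then show ?thesis by (simp add: subst_power_def univ_poly_zero)
  next
    case (Cons a q)
    from assms(1) Cons have a: "a \<in> carrier R - {\<zero>}" and q: "set q \<subseteq> carrier R"
      unfolding sym[OF univ_poly_carrier] polynomial_def by auto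
    let ?m = "poly_of_const a \<otimes>\<^bsub>poly_ring R\<^esub> (X [^]\<^bsub>poly_ring R\<^esub> (n * length q))"
    have m: "?m \<in> carrier (poly_ring R)"
      using a var_pow_closed[OF carrier_is_subring, of "n * length q"] by simp
    have len: "length ?m = Suc (n * length q)"
      by (rule length_monomial[OF a])
    have "n * degree q < n * length q" if "q \<noteq> []"
      using that n by simp
    then have less: "length (?ev q) < length ?m"
      using bound[OF q] unfolding len by (auto intro: le_less_trans split: if_splits)
    have "length (poly_add ?m (?ev q)) = max (length ?m) (length (?ev q))"
      using m ev_closed[OF q] less
      by (intro poly_add_length_eq[OF carrier_is_subring]) (auto simp: univ_poly_carrier)
    then have "length (poly_add ?m (?ev q)) = Suc (n * length q)"
      using less len by simp
    then show ?thesis unfolding subst_power_def Cons ev_Cons by simp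
  qed
qed

text \<open>
  Polynomials are coefficient lists and the operations of \<open>K[X]\<close> are those of \<open>R[X]\<close>; only the
  carriers differ, and the substitution does not look at the carrier.
\<close>

lemma (in domain) subst_power_consistent:
  assumes "subring K R"
  shows "subst_power (R\<lparr>carrier := K\<rparr>) p n = subst_power R p n"
proof -
  interpret UP: domain "poly_ring R"
    by (rule univ_poly_is_domain[OF carrier_is_subring])
  have KX: "(K[X]) = (poly_ring R)\<lparr>carrier := carrier (K[X])\<rparr>"
    by (simp add: univ_poly_def)
  have "carrier (K[X]) \<subseteq> carrier (poly_ring R)"
    using carrier_polynomial_shell[OF assms] by blast
  then have "subring (carrier (K[X])) (poly_ring R)"
    using univ_poly_is_ring[OF assms] KX by (intro UP.ring_incl_imp_subring) auto
  then have eval: "ring.eval (K[X]) = UP.eval"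
    using UP.eval_consistent KX by metis
  have pow: "x [^]\<^bsub>K[X]\<^esub> n = x [^]\<^bsub>poly_ring R\<^esub> n" for x
    by (simp add: nat_pow_def univ_poly_mult univ_poly_one)
  have "X\<^bsub>R\<lparr>carrier := K\<rparr>\<^esub> = X" by (simp add: var_def)
  then show ?thesis
    unfolding subst_power_def univ_poly_consistent[OF assms] poly_of_const_consistent[OF assms]
    by (simp add: eval pow)
qed

section \<open>Counting factors\<close>

text \<open>
  Each prime on the left divides some factor on the right and is cancelled from it, which spends at
  most one factor: the cofactor \<open>q'\<close> either becomes a unit, absorbed into \<open>u\<close>, or stays as a nonunit.
\<close>

lemma (in domain) length_nonunits_le_length_primes:
  assumes "set ps \<subseteq> carrier R" "\<And>p. p \<in> set ps \<Longrightarrow> ring_prime p"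
    and "u \<in> Units R"
    and "set qs \<subseteq> carrier R - Units R"
    and "u \<otimes> foldr (\<otimes>) ps \<one> = foldr (\<otimes>) qs \<one>"
  shows "length qs \<le> length ps"
  using assms
proof (induction ps arbitrary: u qs)
  case Nil
  show ?case
  proof (cases qs)
    case (Cons q qs')
    with Nil have "q \<otimes> foldr (\<otimes>) qs' \<one> \<in> Units R" "q \<in> carrier R" "set qs' \<subseteq> carrier R"
      by (auto simp: Units_closed)
    then have "q \<in> Units R"
      using unit_factor by blast
    with Cons Nil show ?thesis by auto
  qed simp
next
  case (Cons p ps)
  have p: "p \<in> carrier R" "ring_prime p" and ps: "set ps \<subseteq> carrier R" "\<And>p. p \<in> set ps \<Longrightarrow> ring_prime p"
    and u: "u \<in> carrier R"
    using Cons.prems(1-3) by auto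
  note prime = ring_primeE[OF p]
  have qs: "set qs \<subseteq> carrier R" using Cons.prems(4) by blast
  let ?P = "foldr (\<otimes>) ps \<one>"
  have P: "?P \<in> carrier R" by (rule multlist_closed[OF ps(1)])
  have eq: "foldr (\<otimes>) qs \<one> = p \<otimes> (u \<otimes> ?P)"
    using Cons.prems(5) p(1) u P by (simp add: m_lcomm)
  have "p divides foldr (\<otimes>) qs \<one>"
    unfolding eq using u P by (intro dividesI[of "u \<otimes> ?P"]) auto
  then have "\<exists>q\<in>set qs. p divides q"
    using qs
  proof (induction qs)
    case Nil
    then have "p \<in> Units R"
      using divides_unit[OF _ p(1)] by simp
    with prime(3) show ?case unfolding prime_def by blast
  next
    case (Cons q qs)
    from Cons.prems have "q \<in> carrier R" "foldr (\<otimes>) qs \<one> \<in> carrier R"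
      by auto
    with Cons.prems(1) have "p divides q \<or> p divides foldr (\<otimes>) qs \<one>"
      using prime(3) unfolding prime_def by simp
    with Cons show ?case by auto
  qed
  then obtain as q bs where split: "qs = as @ q # bs" and "p divides q"
    by (meson split_list)
  then obtain q' where q': "q' \<in> carrier R" "q = p \<otimes> q'"
    unfolding factor_def by blast
  let ?rest = "foldr (\<otimes>) (as @ bs) \<one>"
  have rest: "set (as @ bs) \<subseteq> carrier R - Units R"
    using Cons.prems(4) split by auto
  then have R: "?rest \<in> carrier R" by (intro multlist_closed) auto
  have "foldr (\<otimes>) qs \<one> = q \<otimes> ?rest"
    using multlist_perm_cong[of qs "q # as @ bs"] qs split by simp
  then have "p \<otimes> (u \<otimes> ?P) = p \<otimes> (q' \<otimes> ?rest)"
    using eq q' p(1) R by (simp add: m_assoc)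
  then have cancelled: "u \<otimes> ?P = q' \<otimes> ?rest"
    using m_lcancel[OF prime(1) p(1)] u P q'(1) R by blast
  show ?case
  proof (cases "q' \<in> Units R")
    case True
    then have "inv q' \<otimes> u \<otimes> ?P = inv q' \<otimes> (q' \<otimes> ?rest)"
      using u P by (simp add: m_assoc cancelled)
    also have "\<dots> = ?rest"
      using True q'(1) R by (simp add: m_assoc[symmetric])
    finally have "length (as @ bs) \<le> length ps"
      using Cons.prems(3) True by (intro Cons.IH[OF ps, of "inv q' \<otimes> u"] rest) auto
    then show ?thesis using split by simp
  next
    case False
    then have "length (q' # as @ bs) \<le> length ps"
      using rest q'(1) cancelled by (intro Cons.IH[OF ps Cons.prems(3)]) auto
    then show ?thesis using split by simp
  qed
qed

lemma (in ring_hom_ring) hom_multlist: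
  "set xs \<subseteq> carrier R \<Longrightarrow> h (foldr (\<otimes>\<^bsub>R\<^esub>) xs \<one>\<^bsub>R\<^esub>) = foldr (\<otimes>\<^bsub>S\<^esub>) (map h xs) \<one>\<^bsub>S\<^esub>"
  by (induction xs) auto

lemma (in field) degree_pos_iff_nonunit:
  assumes "p \<in> carrier (poly_ring R)"
  shows "degree p > 0 \<longleftrightarrow> p \<noteq> [] \<and> p \<notin> Units (poly_ring R)"
  using univ_poly_units'[OF carrier_is_subfield, of p] assms by auto

lemma (in field) const_poly_unit:
  "c \<in> carrier R - {\<zero>} \<Longrightarrow> [c] \<in> Units (poly_ring R)"
  using univ_poly_carrier_units by blast

lemma (in field) subst_power_factorization:
  assumes p: "p \<in> carrier (poly_ring R)" and c: "c \<in> carrier R - {\<zero>}"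
    and qs: "set qs \<subseteq> carrier (poly_ring R)"
    and fact: "subst_power R p n = [c] \<otimes>\<^bsub>poly_ring R\<^esub> foldr (\<otimes>\<^bsub>poly_ring R\<^esub>) qs \<one>\<^bsub>poly_ring R\<^esub>"
  shows "subst_power R p (n * m) = [c] \<otimes>\<^bsub>poly_ring R\<^esub>
    foldr (\<otimes>\<^bsub>poly_ring R\<^esub>) (map (\<lambda>q. subst_power R q m) qs) \<one>\<^bsub>poly_ring R\<^esub>"
proof -
  interpret UP: domain "poly_ring R"
    by (rule univ_poly_is_domain[OF carrier_is_subring])
  define h where "h = (\<lambda>q. subst_power R q m)"
  interpret H: ring_hom_ring "poly_ring R" "poly_ring R" h
    unfolding h_def by (rule ring_hom_ringI2[OF UP.ring_axioms UP.ring_axioms subst_power_hom])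
  have "subst_power R p (n * m) = h (subst_power R p n)"
    unfolding h_def subst_power_compose[OF p] ..
  also have "\<dots> = h [c] \<otimes>\<^bsub>poly_ring R\<^esub> h (foldr (\<otimes>\<^bsub>poly_ring R\<^esub>) qs \<one>\<^bsub>poly_ring R\<^esub>)"
    unfolding fact by (rule H.hom_mult[OF UP.Units_closed[OF const_poly_unit[OF c]] UP.multlist_closed[OF qs]])
  also have "h [c] = [c]"
    unfolding h_def by (rule subst_power_const[OF c])
  also have "h (foldr (\<otimes>\<^bsub>poly_ring R\<^esub>) qs \<one>\<^bsub>poly_ring R\<^esub>) =
      foldr (\<otimes>\<^bsub>poly_ring R\<^esub>) (map h qs) \<one>\<^bsub>poly_ring R\<^esub>"
    by (rule H.hom_multlist[OF qs])
  finally show ?thesis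
    unfolding h_def .
qed

text \<open>
  The crucial uniform bound. After a factorization into hereditarily irreducible polynomials has been
  reached, further substitutions keep every factor irreducible, hence prime, so the number of
  nonconstant factors of \<open>P(x\<^sup>n\<^sup>m)\<close> can never grow beyond it, whatever \<open>m\<close> is.
\<close>

lemma (in field) length_factorization_le_hereditary:
  assumes p: "p \<in> carrier (poly_ring R)" and c: "c \<in> carrier R - {\<zero>}"
    and qs: "\<And>q. q \<in> set qs \<Longrightarrow> hereditarily_irreducible R q"
    and fact: "subst_power R p n = [c] \<otimes>\<^bsub>poly_ring R\<^esub> foldr (\<otimes>\<^bsub>poly_ring R\<^esub>) qs \<one>\<^bsub>poly_ring R\<^esub>"
    and m: "m \<ge> 1" and a: "a \<in> carrier R - {\<zero>}"
    and rs: "\<And>r. r \<in> set rs \<Longrightarrow> r \<in> carrier (poly_ring R) \<and> degree r > 0"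
    and fact': "subst_power R p (n * m) = [a] \<otimes>\<^bsub>poly_ring R\<^esub> foldr (\<otimes>\<^bsub>poly_ring R\<^esub>) rs \<one>\<^bsub>poly_ring R\<^esub>"
  shows "length rs \<le> length qs"
proof -
  interpret UP: principal_domain "poly_ring R"
    by (rule univ_poly_is_principal[OF carrier_is_subfield])
  let ?qs = "map (\<lambda>q. subst_power R q m) qs"
  let ?Q = "foldr (\<otimes>\<^bsub>poly_ring R\<^esub>) ?qs \<one>\<^bsub>poly_ring R\<^esub>"
  let ?R = "foldr (\<otimes>\<^bsub>poly_ring R\<^esub>) rs \<one>\<^bsub>poly_ring R\<^esub>"
  have qs_closed: "set qs \<subseteq> carrier (poly_ring R)"
    using qs unfolding hereditarily_irreducible_def by blast
  then have qs'_closed: "set ?qs \<subseteq> carrier (poly_ring R)"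
    using subst_power_closed by auto
  have prime: "ring_prime\<^bsub>poly_ring R\<^esub> q" if "q \<in> set ?qs" for q
  proof -
    have "pirreducible (carrier R) q"
      using that qs m unfolding hereditarily_irreducible_def by auto
    then show ?thesis
      using pprime_iff_pirreducible[OF carrier_is_subfield, of q] qs'_closed that by blast
  qed
  have units: "[a] \<in> Units (poly_ring R)" "[c] \<in> Units (poly_ring R)"
    using const_poly_unit a c by blast+
  have Q: "?Q \<in> carrier (poly_ring R)" and R: "?R \<in> carrier (poly_ring R)"
    using UP.multlist_closed[OF qs'_closed] UP.multlist_closed[of rs] rs by blast+
  \<comment> \<open>The quotient of the two leading constants is the unit that the counting lemma permits.\<close>
  let ?u = "inv\<^bsub>poly_ring R\<^esub> [a] \<otimes>\<^bsub>poly_ring R\<^esub> [c]"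
  have "?u \<otimes>\<^bsub>poly_ring R\<^esub> ?Q = inv\<^bsub>poly_ring R\<^esub> [a] \<otimes>\<^bsub>poly_ring R\<^esub> ([c] \<otimes>\<^bsub>poly_ring R\<^esub> ?Q)"
    by (rule UP.m_assoc[OF UP.Units_inv_closed[OF units(1)] UP.Units_closed[OF units(2)] Q])
  also have "[c] \<otimes>\<^bsub>poly_ring R\<^esub> ?Q = [a] \<otimes>\<^bsub>poly_ring R\<^esub> ?R"
    using subst_power_factorization[OF p c qs_closed fact, of m] fact' by metis
  also have "inv\<^bsub>poly_ring R\<^esub> [a] \<otimes>\<^bsub>poly_ring R\<^esub> \<dots> = ?R"
    using UP.m_assoc[OF UP.Units_inv_closed[OF units(1)] UP.Units_closed[OF units(1)] R]
      UP.Units_l_inv[OF units(1)] UP.l_one[OF R] by metis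
  finally have eq: "?u \<otimes>\<^bsub>poly_ring R\<^esub> ?Q = ?R" .
  have "?u \<in> Units (poly_ring R)"
    using units by blast
  moreover have "set rs \<subseteq> carrier (poly_ring R) - Units (poly_ring R)"
    using rs degree_pos_iff_nonunit by blast
  ultimately have "length rs \<le> length ?qs"
    using UP.length_nonunits_le_length_primes[OF qs'_closed prime _ _ eq] by blast
  then show ?thesis by simp
qed

text \<open>
  Among all factorizations of the polynomials \<open>P(x\<^sup>n\<^sup>m)\<close> into nonconstant factors, with \<open>m\<close> varying,
  take one with the most factors. If a factor became reducible under a substitution \<open>x \<mapsto> x\<^sup>j\<close>,
  substituting in the whole product and splitting that factor would give a longer factorization of
  \<open>P(x\<^sup>n\<^sup>m\<^sup>j)\<close>. So the factors of a longest factorization are hereditarily irreducible.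
\<close>

lemma (in field) poly_good_heredity_if_bounded:
  assumes p: "p \<in> carrier (poly_ring R)" "p \<noteq> []" and n: "n \<ge> 1"
    and bound: "\<And>m a rs. \<lbrakk> m \<ge> 1; a \<in> carrier R - {\<zero>};
      \<And>r. r \<in> set rs \<Longrightarrow> r \<in> carrier (poly_ring R) \<and> degree r > 0;
      subst_power R p (n * m) = [a] \<otimes>\<^bsub>poly_ring R\<^esub> foldr (\<otimes>\<^bsub>poly_ring R\<^esub>) rs \<one>\<^bsub>poly_ring R\<^esub> \<rbrakk>
      \<Longrightarrow> length rs \<le> N"
  shows "poly_good_heredity R p"
proof -
  interpret UP: domain "poly_ring R"
    by (rule univ_poly_is_domain[OF carrier_is_subring])
  define factorization where "factorization m a rs \<longleftrightarrow> m \<ge> 1 \<and> a \<in> carrier R - {\<zero>} \<and>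
    (\<forall>r \<in> set rs. r \<in> carrier (poly_ring R) \<and> degree r > 0) \<and>
    subst_power R p (n * m) = [a] \<otimes>\<^bsub>poly_ring R\<^esub> foldr (\<otimes>\<^bsub>poly_ring R\<^esub>) rs \<one>\<^bsub>poly_ring R\<^esub>"
    for m :: nat and a rs
  let ?S = "{length rs | m a rs. factorization m a rs}"
  have le: "k \<le> N" if "k \<in> ?S" for k
    using that bound unfolding factorization_def by blast
  have one: "\<one>\<^bsub>poly_ring R\<^esub> = [\<one>]" by (rule univ_poly_one)
  have pn: "subst_power R p n \<in> carrier (poly_ring R)"
    by (rule subst_power_closed[OF p(1)])
  \<comment> \<open>A constant \<open>P\<close> is its own leading coefficient times an empty product.\<close>
  have "?S \<noteq> {}"
  proof (cases "degree p = 0")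
    case True
    then have "p \<in> Units (poly_ring R)"
      using degree_pos_iff_nonunit[OF p(1)] p(2) by simp
    then obtain a where a: "a \<in> carrier R - {\<zero>}" "p = [a]"
      using univ_poly_carrier_units by blast
    then have "factorization 1 a []"
      using subst_power_const[OF a(1)] UP.Units_closed[OF const_poly_unit[OF a(1)]]
      unfolding factorization_def by simp
    then show ?thesis by blast
  next
    case False
    then have "degree (subst_power R p n) > 0"
      using length_subst_power[OF p(1) n] p(2) n by simp
    then have "factorization 1 \<one> [subst_power R p n]"
      unfolding factorization_def using pn one_not_zero UP.l_one UP.r_one by (simp add: one[symmetric])
    then show ?thesis by blast
  qed
  moreover have "finite ?S"
    using le by (meson finite_nat_set_iff_bounded_le)
  ultimately have "Max ?S \<in> ?S"
    by (rule Max_in[rotated])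
  then obtain m a rs where max: "length rs = Max ?S" and fact: "factorization m a rs"
    by auto
  have rs: "r \<in> carrier (poly_ring R)" "degree r > 0" if "r \<in> set rs" for r
    using fact that unfolding factorization_def by blast+
  have "hereditarily_irreducible R q" if q: "q \<in> set rs" for q
    unfolding hereditarily_irreducible_def
  proof (intro conjI allI impI)
    show "q \<in> carrier (poly_ring R)" by (rule rs(1)[OF q])
    fix j :: nat assume j: "j \<ge> 1"
    have degree_pos: "degree (subst_power R r j) > 0" if "r \<in> set rs" for r
      using length_subst_power[OF rs(1)[OF that] j] rs(2)[OF that] j by auto
    have closed: "subst_power R r j \<in> carrier (poly_ring R)" if "r \<in> set rs" for r
      by (rule subst_power_closed[OF rs(1)[OF that]])
    note nonunit = degree_pos_iff_nonunit[OF closed[OF q]]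
    show "pirreducible (carrier R) (subst_power R q j)"
    proof (rule pirreducibleI[OF carrier_is_subring closed[OF q]])
      show "subst_power R q j \<noteq> []" "subst_power R q j \<notin> Units (poly_ring R)"
        using nonunit degree_pos[OF q] by blast+
    next
      fix s t assume s: "s \<in> carrier (poly_ring R)" and t: "t \<in> carrier (poly_ring R)"
        and st: "subst_power R q j = s \<otimes>\<^bsub>poly_ring R\<^esub> t"
      show "s \<in> Units (poly_ring R) \<or> t \<in> Units (poly_ring R)"
      proof (rule ccontr)
        assume nonunits: "\<not> ?thesis"
        have "s \<noteq> []" "t \<noteq> []"
          using st nonunit degree_pos[OF q] UP.l_null[OF t] UP.r_null[OF s]
          unfolding univ_poly_zero by auto
        then have degrees: "degree s > 0" "degree t > 0"
          using nonunits degree_pos_iff_nonunit s t by blast+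
        obtain us vs where split: "rs = us @ q # vs"
          using q by (meson split_list)
        let ?sub = "map (\<lambda>r. subst_power R r j)"
        let ?rs = "?sub us @ s # t # ?sub vs"
        have "set (?sub vs) \<subseteq> carrier (poly_ring R)"
          using closed split by auto
        then have "foldr (\<otimes>\<^bsub>poly_ring R\<^esub>) (?sub vs) \<one>\<^bsub>poly_ring R\<^esub> \<in> carrier (poly_ring R)"
          by (rule UP.multlist_closed)
        then have same: "foldr (\<otimes>\<^bsub>poly_ring R\<^esub>) (?sub rs) \<one>\<^bsub>poly_ring R\<^esub> = foldr (\<otimes>\<^bsub>poly_ring R\<^esub>) ?rs \<one>\<^bsub>poly_ring R\<^esub>"
          using s t unfolding split by (simp add: st UP.m_assoc)
        have "subst_power R p (n * m * j) = [a] \<otimes>\<^bsub>poly_ring R\<^esub>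
            foldr (\<otimes>\<^bsub>poly_ring R\<^esub>) (?sub rs) \<one>\<^bsub>poly_ring R\<^esub>"
          using fact rs(1) unfolding factorization_def
          by (intro subst_power_factorization[OF p(1)]) auto
        moreover have "r \<in> carrier (poly_ring R) \<and> degree r > 0" if "r \<in> set ?rs" for r
          using that s t degrees closed degree_pos unfolding split by auto
        ultimately have "factorization (m * j) a ?rs"
          using fact j unfolding factorization_def same by (simp add: mult.assoc)
        then have "length ?rs \<in> ?S" by blast
        then have "length ?rs \<le> Max ?S"
          using \<open>finite ?S\<close> by (rule Max_ge[rotated])
        then show False
          unfolding max[symmetric] split by simp
      qed
    qed
  qed
  then show ?thesis
    using fact p(1) n unfolding poly_good_heredity_def factorization_def
    by (intro conjI exI[of _ "n * m"] bexI[of _ a] exI[of _ rs]) auto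
qed

lemma (in field) poly_good_heredity_subfield:
  assumes K: "subfield K R" and p: "p \<in> carrier (K[X])" "p \<noteq> []"
    and good: "poly_good_heredity R p"
  shows "poly_good_heredity (R\<lparr>carrier := K\<rparr>) p"
proof -
  interpret K: field "R\<lparr>carrier := K\<rparr>" by (rule subfield_iff(2)[OF K])
  note subring = subfieldE(1)[OF K]
  have ring_eq: "poly_ring (R\<lparr>carrier := K\<rparr>) = (K[X])"
    by (simp add: univ_poly_consistent[OF subring])
  have ops: "(\<otimes>\<^bsub>K[X]\<^esub>) = (\<otimes>\<^bsub>poly_ring R\<^esub>)" "\<one>\<^bsub>K[X]\<^esub> = \<one>\<^bsub>poly_ring R\<^esub>"
    by (simp_all add: univ_poly_mult univ_poly_one)
  have incl: "carrier (K[X]) \<subseteq> carrier (poly_ring R)"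
    using carrier_polynomial_shell[OF subring] by blast
  obtain n c qs where n: "n \<ge> 1" and c: "c \<in> carrier R - {\<zero>}"
    and qs: "\<And>q. q \<in> set qs \<Longrightarrow> hereditarily_irreducible R q"
    and fact: "subst_power R p n = [c] \<otimes>\<^bsub>poly_ring R\<^esub> foldr (\<otimes>\<^bsub>poly_ring R\<^esub>) qs \<one>\<^bsub>poly_ring R\<^esub>"
    using good unfolding poly_good_heredity_def by blast
  have pR: "p \<in> carrier (poly_ring R)" using p incl by blast
  show ?thesis
  proof (rule K.poly_good_heredity_if_bounded[OF _ p(2) n])
    show "p \<in> carrier (poly_ring (R\<lparr>carrier := K\<rparr>))" unfolding ring_eq by (rule p(1))
    fix m a rs
    assume m: "m \<ge> 1" and a: "a \<in> carrier (R\<lparr>carrier := K\<rparr>) - {\<zero>\<^bsub>R\<lparr>carrier := K\<rparr>\<^esub>}"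
      and rs: "\<And>r. r \<in> set rs \<Longrightarrow> r \<in> carrier (poly_ring (R\<lparr>carrier := K\<rparr>)) \<and> degree r > 0"
      and eq: "subst_power (R\<lparr>carrier := K\<rparr>) p (n * m) = [a] \<otimes>\<^bsub>poly_ring (R\<lparr>carrier := K\<rparr>)\<^esub>
        foldr (\<otimes>\<^bsub>poly_ring (R\<lparr>carrier := K\<rparr>)\<^esub>) rs \<one>\<^bsub>poly_ring (R\<lparr>carrier := K\<rparr>)\<^esub>"
    have aR: "a \<in> carrier R - {\<zero>}"
      using a subfieldE(3)[OF K] by auto
    have rsR: "r \<in> carrier (poly_ring R) \<and> degree r > 0" if "r \<in> set rs" for r
      using rs[OF that] incl unfolding ring_eq by blast
    show "length rs \<le> length qs"
      using length_factorization_le_hereditary[OF pR c qs fact m aR rsR]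
        eq[unfolded subst_power_consistent[OF subring] ring_eq ops] by blast
  qed
qed

section \<open>Roots in different algebraic closures\<close>

lemma (in algebraically_closed) nonconstant_has_root:
  assumes "p \<in> carrier (poly_ring L)" "degree p > 0"
  shows "\<exists>x \<in> carrier L. eval p x = \<zero>"
proof -
  have "size (roots p) > 0"
    using roots_over_carrier[OF assms(1)] assms(2) unfolding splitted_def by simp
  then obtain x where "x \<in># roots p" by fastforce
  then show ?thesis
    using roots_mem_iff_is_root[OF assms(1)] unfolding is_root_def by blast
qed

text \<open>
  Having a common root in some extension field is a property of the two polynomials over the ground
  field. The polynomials vanishing at the point \<open>x\<close> of \<open>A\<close> form a proper ideal of the principal
  ideal domain \<open>R[X]\<close>; its generator \<open>D\<close> is nonconstant and therefore has a root in \<open>B\<close>, at which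
  all multiples of \<open>D\<close> vanish. That \<open>Q\<close> is nonzero ensures that \<open>D\<close> is nonzero, that is, that \<open>x\<close> is
  not transcendental.
\<close>

lemma (in field) common_root_in_algebraically_closed:
  assumes "field A" "f \<in> ring_hom R A"
    and "algebraically_closed B" "g \<in> ring_hom R B"
    and P: "P \<in> carrier (poly_ring R)" and Q: "Q \<in> carrier (poly_ring R)" "Q \<noteq> []"
    and x: "x \<in> carrier A" "ring.eval A (map f P) x = \<zero>\<^bsub>A\<^esub>" "ring.eval A (map f Q) x = \<zero>\<^bsub>A\<^esub>"
  shows "\<exists>y \<in> carrier B. ring.eval B (map g P) y = \<zero>\<^bsub>B\<^esub> \<and> ring.eval B (map g Q) y = \<zero>\<^bsub>B\<^esub>"
proof -
  interpret A: field A by (rule assms(1))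
  interpret B: algebraically_closed B by (rule assms(3))
  interpret UP: principal_domain "poly_ring R"
    by (rule univ_poly_is_principal[OF carrier_is_subfield])
  interpret f: ring_hom_ring R A f
    by (rule ring_hom_ringI2[OF ring_axioms A.ring_axioms assms(2)])
  interpret g: ring_hom_ring R B g
    by (rule ring_hom_ringI2[OF ring_axioms B.ring_axioms assms(4)])
  define ev where "ev = (\<lambda>p. A.eval (map f p) x)"
  interpret ev: ring_hom_ring "poly_ring R" A ev
    unfolding ev_def
    by (rule ring_hom_ringI2[OF UP.ring_axioms A.ring_axioms f.eval_map_ring_hom[OF A.is_cring x(1)]])
  obtain D where D: "D \<in> carrier (poly_ring R)"
    and ker: "a_kernel (poly_ring R) A ev = PIdl\<^bsub>poly_ring R\<^esub> D"
    using UP.exists_gen[OF ev.kernel_is_ideal] by blast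
  have "D \<in> a_kernel (poly_ring R) A ev"
    unfolding ker by (rule UP.cgenideal_self[OF D])
  then have evD: "ev D = \<zero>\<^bsub>A\<^esub>" unfolding a_kernel_def' by blast
  have divides: "\<exists>r \<in> carrier (poly_ring R). p = r \<otimes>\<^bsub>poly_ring R\<^esub> D"
    if "p \<in> carrier (poly_ring R)" "ev p = \<zero>\<^bsub>A\<^esub>" for p
  proof -
    have "p \<in> PIdl\<^bsub>poly_ring R\<^esub> D"
      using that unfolding ker[symmetric] a_kernel_def' by blast
    then show ?thesis unfolding cgenideal_def by blast
  qed
  have "D \<noteq> []"
    using divides[OF Q(1)] x(3) Q(2) unfolding ev_def 
    by (metis UP.r_null univ_poly_zero)
  moreover have "D \<notin> Units (poly_ring R)"
  proof
    assume "D \<in> Units (poly_ring R)"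
    then obtain r where "r \<in> carrier (poly_ring R)" "r \<otimes>\<^bsub>poly_ring R\<^esub> D = \<one>\<^bsub>poly_ring R\<^esub>"
      unfolding Units_def by blast
    then have "ev r \<otimes>\<^bsub>A\<^esub> ev D = \<one>\<^bsub>A\<^esub>"
      using ev.hom_mult[of r D] D ev.hom_one by metis
    then show False
      using evD \<open>r \<in> carrier (poly_ring R)\<close> by simp
  qed
  ultimately have "degree D > 0"
    using univ_poly_units'[OF carrier_is_subfield, of D] D gr0I by blast
  then have "degree (map g D) > 0" by (simp only: length_map)
  then obtain y where y: "y \<in> carrier B" "B.eval (map g D) y = \<zero>\<^bsub>B\<^esub>"
    using B.nonconstant_has_root[OF polynomial_hom[OF assms(4) field_axioms B.field_axioms D]] by blast
  define evB where "evB = (\<lambda>p. B.eval (map g p) y)"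
  interpret evB: ring_hom_ring "poly_ring R" B evB
    unfolding evB_def
    by (rule ring_hom_ringI2[OF UP.ring_axioms B.ring_axioms g.eval_map_ring_hom[OF B.is_cring y(1)]])
  have evB: "evB p = \<zero>\<^bsub>B\<^esub>" if p: "p \<in> carrier (poly_ring R)" "ev p = \<zero>\<^bsub>A\<^esub>" for p
  proof -
    obtain r where r: "r \<in> carrier (poly_ring R)" "p = r \<otimes>\<^bsub>poly_ring R\<^esub> D"
      using divides[OF p] by blast
    have "evB D = \<zero>\<^bsub>B\<^esub>" unfolding evB_def by (rule y(2))
    then show ?thesis
      using evB.hom_mult[OF r(1) D] B.r_null[OF evB.hom_closed[OF r(1)]]
      unfolding r(2) by metis
  qed
  show ?thesis
    using evB[OF P] evB[OF Q(1)] x(2,3) y(1) unfolding ev_def evB_def by blast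
qed

lemma (in domain) var_pow_minus_one_not_zero:
  assumes "n \<ge> 1"
  shows "X [^]\<^bsub>poly_ring R\<^esub> (n::nat) \<ominus>\<^bsub>poly_ring R\<^esub> \<one>\<^bsub>poly_ring R\<^esub> \<noteq> []"
proof
  interpret UP: domain "poly_ring R"
    by (rule univ_poly_is_domain[OF carrier_is_subring])
  assume "X [^]\<^bsub>poly_ring R\<^esub> n \<ominus>\<^bsub>poly_ring R\<^esub> \<one>\<^bsub>poly_ring R\<^esub> = []"
  then have "X [^]\<^bsub>poly_ring R\<^esub> n = \<one>\<^bsub>poly_ring R\<^esub>"
    using UP.r_right_minus_eq[OF var_pow_closed[OF carrier_is_subring] UP.one_closed, of n]
    by (simp add: univ_poly_zero)
  then have "monom \<one> n = [\<one>]"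
    using unitary_monom_eq_var_pow[OF carrier_is_subring, of n] by (simp add: univ_poly_one)
  then show False
    using assms by (simp add: monom_def)
qed

lemma (in ring_hom_ring) eval_map_var_pow_minus_one:
  assumes "domain R" "cring S" and x: "x \<in> carrier S"
  shows "S.eval (map h (X\<^bsub>R\<^esub> [^]\<^bsub>poly_ring R\<^esub> (n::nat) \<ominus>\<^bsub>poly_ring R\<^esub> \<one>\<^bsub>poly_ring R\<^esub>)) x
    = x [^]\<^bsub>S\<^esub> n \<ominus>\<^bsub>S\<^esub> \<one>\<^bsub>S\<^esub>"
proof -
  interpret R: domain R by (rule assms(1))
  interpret UP: domain "poly_ring R"
    by (rule R.univ_poly_is_domain[OF R.carrier_is_subring])
  define ev where "ev = (\<lambda>p. S.eval (map h p) x)"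
  interpret ev: ring_hom_ring "poly_ring R" S ev
    unfolding ev_def
    by (rule ring_hom_ringI2[OF UP.ring_axioms S.ring_axioms eval_map_ring_hom[OF assms(2) x]])
  note X = R.var_closed(1)[OF R.carrier_is_subring]
  have "ev X\<^bsub>R\<^esub> = x"
    unfolding ev_def using x by (simp add: var_def)
  then have "ev (X\<^bsub>R\<^esub> [^]\<^bsub>poly_ring R\<^esub> n \<ominus>\<^bsub>poly_ring R\<^esub> \<one>\<^bsub>poly_ring R\<^esub>) = x [^]\<^bsub>S\<^esub> n \<ominus>\<^bsub>S\<^esub> \<one>\<^bsub>S\<^esub>"
    unfolding a_minus_def using X by (simp add: ev.hom_nat_pow)
  then show ?thesis unfolding ev_def .
qed

text \<open>
  What remains is to see that the restriction on the roots of \<open>P\<close> does not depend on the field: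
  \<open>0\<close> and the roots of unity are the roots of \<open>X\<close> and of the \<open>X\<^sup>n - 1\<close>, which have coefficients in
  the smaller field, so a forbidden root in one closure is a common root that transfers to the other.
\<close>

lemma (in field) good_heredity_subfield:
  assumes K: "subfield K R" and good: "good_heredity R"
  shows "good_heredity (R\<lparr>carrier := K\<rparr>)"
  unfolding good_heredity_def
proof (intro ballI impI)
  let ?K = "R\<lparr>carrier := K\<rparr>"
  interpret K: field ?K by (rule subfield_iff(2)[OF K])
  let ?A = "alg_closure" and ?B = "K.alg_closure"
  interpret A: algebraic_closure ?A "indexed_const ` carrier R" by (rule alg_closureE(1))
  interpret B: algebraic_closure ?B "K.indexed_const ` carrier ?K" by (rule K.alg_closureE(1))
  have f: "indexed_const \<in> ring_hom ?K ?A"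
    using alg_closureE(2) subfieldE(3)[OF K] unfolding ring_hom_def by auto
  note g = K.alg_closureE(2)
  interpret f: ring_hom_ring ?K ?A indexed_const
    by (rule ring_hom_ringI2[OF K.ring_axioms A.ring_axioms f])
  interpret g: ring_hom_ring ?K ?B K.indexed_const
    by (rule ring_hom_ringI2[OF K.ring_axioms B.ring_axioms g])
  fix p
  assume p: "p \<in> carrier (poly_ring ?K)"
    and roots: "\<forall>y \<in> carrier ?B. B.eval (map K.indexed_const p) y = \<zero>\<^bsub>?B\<^esub> \<longrightarrow>
      y \<noteq> \<zero>\<^bsub>?B\<^esub> \<and> \<not> root_of_unity ?B y"
  \<comment> \<open>The zero polynomial has the root zero, so the assumption on the roots excludes it.\<close>
  have "p \<noteq> []"
    using roots by auto
  have pK: "p \<in> carrier (K[X])"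
    using p univ_poly_consistent[OF subfieldE(1)[OF K]] by simp
  then have pR: "p \<in> carrier (poly_ring R)"
    by (rule carrier_polynomial_shell[OF subfieldE(1)[OF K]])
  have no_common_root: False
    if "x \<in> carrier ?A" "A.eval (map indexed_const p) x = \<zero>\<^bsub>?A\<^esub>" "A.eval (map indexed_const q) x = \<zero>\<^bsub>?A\<^esub>"
      and q: "q \<in> carrier (poly_ring ?K)" "q \<noteq> []"
      and q_root: "\<And>y. y \<in> carrier ?B \<Longrightarrow> B.eval (map K.indexed_const q) y = \<zero>\<^bsub>?B\<^esub>
        \<Longrightarrow> y = \<zero>\<^bsub>?B\<^esub> \<or> root_of_unity ?B y" for x q
    using K.common_root_in_algebraically_closed[OF A.field_axioms f B.algebraically_closed_axioms g p q that(1-3)]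
      roots q_root by blast
  have "x \<noteq> \<zero>\<^bsub>?A\<^esub> \<and> \<not> root_of_unity ?A x"
    if x: "x \<in> carrier ?A" and px: "A.eval (map indexed_const p) x = \<zero>\<^bsub>?A\<^esub>" for x
  proof (intro conjI notI)
    note X = K.var_closed(1)[OF K.carrier_is_subring]
    have X_eq: "X\<^bsub>?K\<^esub> = [\<one>\<^bsub>?K\<^esub>, \<zero>\<^bsub>?K\<^esub>]" by (simp add: var_def)
    assume "x = \<zero>\<^bsub>?A\<^esub>"
    then have "A.eval (map indexed_const X\<^bsub>?K\<^esub>) x = \<zero>\<^bsub>?A\<^esub>"
      unfolding X_eq using f.hom_one f.hom_zero by simp
    moreover have "B.eval (map K.indexed_const X\<^bsub>?K\<^esub>) y = y" if "y \<in> carrier ?B" for y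
      unfolding X_eq using that g.hom_one g.hom_zero by simp
    ultimately show False
      using no_common_root[OF x px _ X] by (simp add: var_def)
  next
    assume "root_of_unity ?A x"
    then obtain n :: nat where n: "n \<ge> 1" "x [^]\<^bsub>?A\<^esub> n = \<one>\<^bsub>?A\<^esub>"
      unfolding root_of_unity_def by blast
    let ?q = "X\<^bsub>?K\<^esub> [^]\<^bsub>poly_ring ?K\<^esub> n \<ominus>\<^bsub>poly_ring ?K\<^esub> \<one>\<^bsub>poly_ring ?K\<^esub>"
    interpret UK: domain "poly_ring ?K"
      by (rule K.univ_poly_is_domain[OF K.carrier_is_subring])
    have q: "?q \<in> carrier (poly_ring ?K)"
      by (rule UK.minus_closed[OF K.var_pow_closed[OF K.carrier_is_subring] UK.one_closed])
    show False
    proof (rule no_common_root[OF x px _ q K.var_pow_minus_one_not_zero[OF n(1)]])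
      show "A.eval (map indexed_const ?q) x = \<zero>\<^bsub>?A\<^esub>"
        unfolding f.eval_map_var_pow_minus_one[OF K.domain_axioms A.is_cring x] n(2)
        by (simp add: A.r_neg a_minus_def)
    next
      fix y assume y: "y \<in> carrier ?B" "B.eval (map K.indexed_const ?q) y = \<zero>\<^bsub>?B\<^esub>"
      then have "y [^]\<^bsub>?B\<^esub> n \<ominus>\<^bsub>?B\<^esub> \<one>\<^bsub>?B\<^esub> = \<zero>\<^bsub>?B\<^esub>"
        using g.eval_map_var_pow_minus_one[OF K.domain_axioms B.is_cring y(1), of n] by metis
      then have "y [^]\<^bsub>?B\<^esub> n = \<one>\<^bsub>?B\<^esub>"
        using B.r_right_minus_eq[OF B.nat_pow_closed[OF y(1)] monoid.one_closed[OF ring.is_monoid[OF B.ring_axioms]]] by blast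
      then show "y = \<zero>\<^bsub>?B\<^esub> \<or> root_of_unity ?B y"
        unfolding root_of_unity_def using n(1) y(1) by blast
    qed
  qed
  then have "poly_good_heredity R p"
    using good pR unfolding good_heredity_def by blast
  then show "poly_good_heredity ?K p"
    by (rule poly_good_heredity_subfield[OF K pK \<open>p \<noteq> []\<close>])
qed

section \<open>Rootlessness and the theorem\<close>

lemma (in ring) root_of_unity_subring:
  "K \<subseteq> carrier R \<Longrightarrow> root_of_unity (R\<lparr>carrier := K\<rparr>) a \<longleftrightarrow> a \<in> K \<and> root_of_unity R a"
  unfolding root_of_unity_def by (auto simp: nat_pow_consistent[symmetric])

lemma (in ring) rootless_subring:
  assumes "K \<subseteq> carrier R" "rootless R"
  shows "rootless (R\<lparr>carrier := K\<rparr>)"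
  unfolding rootless_def rootless_elem_def
proof (intro ballI impI conjI)
  fix a assume a: "a \<in> carrier (R\<lparr>carrier := K\<rparr>)" "a \<noteq> \<zero>\<^bsub>R\<lparr>carrier := K\<rparr>\<^esub>"
    "\<not> root_of_unity (R\<lparr>carrier := K\<rparr>) a"
  then have "finite {n::nat. n \<ge> 1 \<and> (\<exists>x \<in> carrier R. x [^] n = a)}"
    using assms unfolding rootless_def rootless_elem_def by (auto simp: root_of_unity_subring)
  then show "finite {n::nat. n \<ge> 1 \<and> (\<exists>x \<in> carrier (R\<lparr>carrier := K\<rparr>). x [^]\<^bsub>R\<lparr>carrier := K\<rparr>\<^esub> n = a)}"
    by (rule rev_finite_subset) (use assms(1) in \<open>auto simp: nat_pow_consistent[symmetric]\<close>)
qed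

lemma (in ring) rootless_modtor_subring:
  assumes "K \<subseteq> carrier R" "rootless_modtor R"
  shows "rootless_modtor (R\<lparr>carrier := K\<rparr>)"
  unfolding rootless_modtor_def rootless_modtor_elem_def
proof (intro ballI impI conjI)
  fix a assume a: "a \<in> carrier (R\<lparr>carrier := K\<rparr>)" "a \<noteq> \<zero>\<^bsub>R\<lparr>carrier := K\<rparr>\<^esub>"
    "\<not> root_of_unity (R\<lparr>carrier := K\<rparr>) a"
  then have "finite {n::nat. n \<ge> 1 \<and> (\<exists>\<zeta>. root_of_unity R \<zeta> \<and> (\<exists>x \<in> carrier R. x [^] n = \<zeta> \<otimes> a))}"
    using assms unfolding rootless_modtor_def rootless_modtor_elem_def by (auto simp: root_of_unity_subring)
  then show "finite {n::nat. n \<ge> 1 \<and> (\<exists>\<zeta>. root_of_unity (R\<lparr>carrier := K\<rparr>) \<zeta> \<and>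
      (\<exists>x \<in> carrier (R\<lparr>carrier := K\<rparr>). x [^]\<^bsub>R\<lparr>carrier := K\<rparr>\<^esub> n = \<zeta> \<otimes>\<^bsub>R\<lparr>carrier := K\<rparr>\<^esub> a))}"
    by (rule rev_finite_subset)
      (use assms(1) in \<open>auto simp: nat_pow_consistent[symmetric] root_of_unity_subring\<close>)
qed

theorem mainTheorem3:
  fixes E :: "('a, 'b) ring_scheme" and F :: "'a set"
  assumes "field E" and "subfield F E"
  shows "(rootless E \<longrightarrow> rootless (E\<lparr>carrier := F\<rparr>)) \<and>
         (rootless_modtor E \<longrightarrow> rootless_modtor (E\<lparr>carrier := F\<rparr>)) \<and>
         (good_heredity E \<longrightarrow> good_heredity (E\<lparr>carrier := F\<rparr>))"
proof -
  interpret E: field E by (rule assms(1))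
  show ?thesis
    using E.rootless_subring E.rootless_modtor_subring E.good_heredity_subfield[OF assms(2)]
      subfieldE(3)[OF assms(2)] by blast
qed

end
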